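(* For each integer $n\geq 2$, $$(n+3)\,J_{n+2}(0) < (n+2)\,J_n(0).$$
   Context: For a positive integer $n$ and $r\in\mathbb{R}$, the Laplace–Pólya integral is $$J_n(r) = \frac1\pi\int_{-\infty}^{\infty} (\operatorname{sinc} t)^n\cos(rt)\,dt,$$ where $\operatorname{sinc} x = \frac{\sin x}{x}$ for $x\neq 0$ and $\operatorname{sinc} 0 = 1$. *)

theory Defs
  imports "HOL-Probability.Sinc_Integral"
begin

(* The Henstock-Kurzweil integral over the whole line agrees with the Lebesgue integral
   for n >= 2 and also gives the conditionally convergent improper integral for n = 1.
   n = 0 is outside the intended range. *)
definition laplace_polya :: "nat \<Rightarrow> real \<Rightarrow> real" where
  "laplace_polya n r =
     (1 / pi) * Henstock_Kurzweil_Integration.integral UNIV (\<lambda>t::real. sinc t ^ n * cos (r * t))"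

end

(* Integration by parts gives the three-term recursion
     2 n J_{n+1}(r) = (n + 1 + r) J_n(r + 1) + (n + 1 - r) J_n(r - 1),
   which together with the explicit J_2 determines J_n at the integers. Applying it twice, the
   claim becomes (n + 2) (n + 3) J_n(2) < n (n - 1) J_n(0). The recursion expresses
   J_{n+1}(s + 1) / J_{n+1}(s - 1) as an increasing function of the two neighbouring ratios at
   level n, so an upper bound for all these ratios follows by induction once it is preserved by
   that function; the bound p(s) / p(-s) with p = ratio_poly (n + 1) is, and at s = 1 it is
   slightly below n (n - 1) / ((n + 2) (n + 3)). *)
theory Submission
  imports Defs
begin

section \<open>Integrals over the half-line and the values of J_2\<close>

text \<open>For positive \<open>a\<close>, integration by parts leads to an antiderivative
  containing the sine integral \<open>Si\<close>, whose limit pi / 2 at infinity gives the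
  value.\<close>

lemma
  fixes a :: real
  shows integrable_one_minus_cos_div_square:
      "set_integrable lborel {0<..} (\<lambda>t. (1 - cos (a * t)) / t\<^sup>2)"
    and LBINT_one_minus_cos_div_square:
      "(LBINT t:{0<..}. (1 - cos (a * t)) / t\<^sup>2) = pi / 2 * \<bar>a\<bar>"
proof -
  \<comment> \<open>Only positive \<open>a\<close> needs work: the integrand is even in
    \<open>a\<close> and vanishes for \<open>a = 0\<close>.\<close>
  have *: "set_integrable lborel {0<..} (\<lambda>t. (1 - cos (a * t)) / t\<^sup>2) \<and>
      (LBINT t:{0<..}. (1 - cos (a * t)) / t\<^sup>2) = pi / 2 * a" if a: "a > 0" for a :: real
  proof -
    define f where "f = (\<lambda>t. (1 - cos (a * t)) / t\<^sup>2)"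
    define F where "F = (\<lambda>t. a * Si (a * t) - (1 - cos (a * t)) / t)"
    have deriv: "DERIV F x :> f x" if "0 < x" for x
    proof -
      have "DERIV F x :> a * (sinc (a * x) * a) - (sin (a * x) * a * x - (1 - cos (a * x))) / (x * x)"
        unfolding F_def using that
        by (auto intro!: derivative_eq_intros DERIV_chain2[OF DERIV_Si])
      moreover have "a * (sinc (a * x) * a) - (sin (a * x) * a * x - (1 - cos (a * x))) / (x * x) = f x"
      proof -
        have "sinc (a * x) * a = sin (a * x) / x"
          using that a by simp
        then show ?thesis
          using that by (simp only:) (simp add: f_def field_simps power2_eq_square)
      qed
      ultimately show ?thesis by simp
    qed
    \<comment> \<open>For a nonnegative derivative, the limits of \<open>F\<close> at both ends
      yield integrability together with the value.\<close>
    have nonneg: "0 \<le> f x" for x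
      by (simp add: f_def)
    have lim0: "(F \<longlongrightarrow> 0) (at_right 0)"
    proof -
      have "((\<lambda>t. a * Si (a * t)) \<longlongrightarrow> a * Si (a * 0)) (at_right 0)"
        by (intro tendsto_intros isCont_tendsto_compose[OF isCont_Si])
      moreover have "((\<lambda>t. (1 - cos (a * t)) / t) \<longlongrightarrow> 0) (at_right 0)"
      proof -
        \<comment> \<open>The function whose limit is sought is the difference quotient of
          \<open>1 - cos (a * t)\<close> at 0.\<close>
        have "DERIV (\<lambda>t. 1 - cos (a * t)) 0 :> 0"
          by (auto intro!: derivative_eq_intros)
        then have "((\<lambda>t. (1 - cos (a * t)) / t) \<longlongrightarrow> 0) (at 0)"
          by (simp add: DERIV_def)
        then show ?thesis by (rule tendsto_within_subset) simp
      qed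
      moreover have "Si 0 = 0"
        by (simp add: Si_def zero_ereal_def)
      ultimately show ?thesis
        unfolding F_def by (auto intro: tendsto_eq_intros)
    qed
    have liminf: "(F \<longlongrightarrow> a * (pi / 2)) at_top"
    proof -
      have "filterlim (\<lambda>t. a * t) at_top at_top"
        using a by (intro filterlim_tendsto_pos_mult_at_top[OF tendsto_const] filterlim_ident)
      then have "((\<lambda>t. a * Si (a * t)) \<longlongrightarrow> a * (pi / 2)) at_top"
        by (intro tendsto_intros filterlim_compose[OF Si_at_top])
      moreover have "((\<lambda>t. (1 - cos (a * t)) / t) \<longlongrightarrow> 0) at_top"
      proof (rule Lim_null_comparison)
        show "\<forall>\<^sub>F t in at_top. norm ((1 - cos (a * t)) / t) \<le> 2 / t"
          using eventually_gt_at_top[of 0]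
        proof eventually_elim
          case (elim t)
          have "\<bar>1 - cos (a * t)\<bar> \<le> 2"
            using cos_ge_minus_one[of "a * t"] cos_le_one[of "a * t"] by linarith
          then show ?case
            using elim by (simp add: divide_right_mono)
        qed
        show "((\<lambda>t. 2 / t :: real) \<longlongrightarrow> 0) at_top"
          by (intro tendsto_divide_0[OF tendsto_const] filterlim_at_top_imp_at_infinity filterlim_ident)
      qed
      ultimately show ?thesis
        unfolding F_def by (auto intro: tendsto_eq_intros)
    qed
    have lims: "((F \<circ> real_of_ereal) \<longlongrightarrow> 0) (at_right 0)"
      "((F \<circ> real_of_ereal) \<longlongrightarrow> a * (pi / 2)) (at_left \<infinity>)"
      using lim0 liminf unfolding zero_ereal_def ereal_tendsto_simps .
    have cont: "isCont f x" if "0 < x" for x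
      unfolding f_def using that by (auto intro!: continuous_intros)
    have "set_integrable lborel (einterval 0 \<infinity>) f" "(LBINT x=0..\<infinity>. f x) = a * (pi / 2) - 0"
      by (rule interval_integral_FTC_nonneg[where F = F]; use deriv nonneg cont lims in auto)+
    then show ?thesis
      by (simp add: f_def interval_integral_to_infinity_eq zero_ereal_def mult.commute)
  qed
  consider "a > 0" | "a = 0" | "- a > 0" by linarith
  then have "set_integrable lborel {0<..} (\<lambda>t. (1 - cos (a * t)) / t\<^sup>2) \<and>
      (LBINT t:{0<..}. (1 - cos (a * t)) / t\<^sup>2) = pi / 2 * \<bar>a\<bar>"
  proof cases
    case 2
    then show ?thesis by (simp add: set_integrable_def)
  qed (use *[of a] *[of "- a"] in auto)
  then show "set_integrable lborel {0<..} (\<lambda>t. (1 - cos (a * t)) / t\<^sup>2)"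
    "(LBINT t:{0<..}. (1 - cos (a * t)) / t\<^sup>2) = pi / 2 * \<bar>a\<bar>"
    by auto
qed

text \<open>As \<open>sin t / t\<close> is at most 1 in absolute value, the powers from 2 on are
  dominated by the square, which is half of \<open>(1 - cos (2 * t)) / t ^ 2\<close>.\<close>

lemma set_integrable_sinc_power_bounded:
  fixes h :: "real \<Rightarrow> real"
  assumes "n \<ge> 2" and [measurable]: "h \<in> borel_measurable borel" and h: "\<And>t. \<bar>h t\<bar> \<le> 1"
  shows "set_integrable lborel {0<..} (\<lambda>t. (sin t / t) ^ n * h t)"
proof -
  have "set_integrable lborel {0<..} (\<lambda>t :: real. 1 / 2 * ((1 - cos (2 * t)) / t\<^sup>2))"
    by (intro set_integrable_mult_right integrable_one_minus_cos_div_square)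
  then show ?thesis
    unfolding set_integrable_def
  proof (rule Bochner_Integration.integrable_bound)
    show "AE t in lborel. norm (indicator {0<..} t *\<^sub>R ((sin t / t) ^ n * h t))
        \<le> norm (indicator {0<..} t *\<^sub>R (1 / 2 * ((1 - cos (2 * t)) / t\<^sup>2)))"
    proof (rule AE_I2)
      fix t :: real
      have "\<bar>sin t / t\<bar> \<le> 1" if "t > 0"
        using that abs_sin_x_le_abs_x[of t] by simp
      then have "\<bar>sin t / t\<bar> ^ n \<le> \<bar>sin t / t\<bar>\<^sup>2" if "t > 0"
        using that assms(1) by (intro power_decreasing) auto
      then have "\<bar>sin t / t\<bar> ^ n * \<bar>h t\<bar> \<le> \<bar>sin t / t\<bar>\<^sup>2 * 1" if "t > 0"
        using that h[of t] by (intro mult_mono) auto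
      moreover have "\<bar>sin t / t\<bar>\<^sup>2 = 1 / 2 * ((1 - cos (2 * t)) / t\<^sup>2)"
        by (simp add: cos_double_sin power_divide)
      ultimately show "norm (indicator {0<..} t *\<^sub>R ((sin t / t) ^ n * h t))
        \<le> norm (indicator {0<..} t *\<^sub>R (1 / 2 * ((1 - cos (2 * t)) / t\<^sup>2)))"
        by (auto simp: abs_mult power_abs split: split_indicator)
    qed
  qed measurable
qed

text \<open>The integrand is even, and \<open>sinc t\<close> differs from \<open>sin t / t\<close>
  only at 0. Lebesgue integrability identifies the Henstock-Kurzweil integral with the Lebesgue
  integral.\<close>

lemma laplace_polya_eq_LBINT:
  assumes "n \<ge> 2"
  shows "laplace_polya n r = 2 / pi * (LBINT t:{0<..}. (sin t / t) ^ n * cos (r * t))"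
proof -
  define f where "f = (\<lambda>t. sinc t ^ n * cos (r * t))"
  define I where "I = (LBINT t:{0<..}. (sin t / t) ^ n * cos (r * t))"
  have "has_bochner_integral lborel (\<lambda>t. indicator {0<..} t *\<^sub>R ((sin t / t) ^ n * cos (r * t))) I"
    using set_integrable_sinc_power_bounded[OF assms, of "\<lambda>t. cos (r * t)"]
    unfolding I_def set_lebesgue_integral_def set_integrable_def
    by (intro has_bochner_integral_integrable) auto
  also have "?this \<longleftrightarrow> has_bochner_integral lborel (\<lambda>t. indicator {0..} t *\<^sub>R f t) I"
    using AE_lborel_singleton[of 0]
    by (intro has_bochner_integral_cong_AE) (auto simp: f_def split: split_indicator)
  finally have "has_bochner_integral lborel f (2 *\<^sub>R I)"
    by (rule has_bochner_integral_even_function) (simp add: f_def)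
  then have "integrable lborel f" "integral\<^sup>L lborel f = 2 * I"
    by (auto simp: has_bochner_integral_iff)
  then have "Henstock_Kurzweil_Integration.integral UNIV f = 2 * I"
    by (metis integral_lborel)
  then show ?thesis
    by (simp add: laplace_polya_def f_def I_def)
qed

lemma laplace_polya_uminus: "laplace_polya n (- r) = laplace_polya n r"
  by (simp add: laplace_polya_def)

text \<open>Supplies the base case of every induction on \<open>n\<close> below. Product-to-sum
  formulas split the integrand into terms \<open>g a\<close> with \<open>a\<close> equal to
  \<open>r + 2\<close>, \<open>r - 2\<close> and \<open>r\<close>; the constants in their numerators
  cancel.\<close>

lemma laplace_polya_2: "laplace_polya 2 r = (\<bar>r + 2\<bar> + \<bar>r - 2\<bar> - 2 * \<bar>r\<bar>) / 4"
proof -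
  define g where "g = (\<lambda>a t :: real. (1 - cos (a * t)) / t\<^sup>2)"
  have int: "set_integrable lborel {0<..} (g a)" for a
    unfolding g_def by (rule integrable_one_minus_cos_div_square)
  have val: "(LBINT t:{0<..}. g a t) = pi / 2 * \<bar>a\<bar>" for a
    unfolding g_def by (rule LBINT_one_minus_cos_div_square)
  have "(sin t / t)\<^sup>2 * cos (r * t) = (g (r + 2) t + g (r - 2) t - 2 * g r t) / 4" for t
  proof -
    have "cos ((r + 2) * t) + cos ((r - 2) * t) = 2 * cos (r * t) * cos (2 * t)"
      by (simp add: ring_distribs cos_add cos_diff)
    then have "(sin t)\<^sup>2 * cos (r * t) = (2 * cos (r * t) - cos ((r + 2) * t) - cos ((r - 2) * t)) / 4"
      unfolding cos_double_sin[of t] by (simp add: algebra_simps)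
    then show ?thesis
      by (simp add: g_def power_divide) (simp add: diff_divide_distrib add_divide_distrib)
  qed
  then have "(LBINT t:{0<..}. (sin t / t)\<^sup>2 * cos (r * t)) =
      (LBINT t:{0<..}. (g (r + 2) t + g (r - 2) t - 2 * g r t) / 4)"
    by presburger
  also have "\<dots> = (pi / 2 * \<bar>r + 2\<bar> + pi / 2 * \<bar>r - 2\<bar> - 2 * (pi / 2 * \<bar>r\<bar>)) / 4"
    using int by (simp add: set_integral_add set_integral_diff val)
  finally show ?thesis
    by (simp add: laplace_polya_eq_LBINT field_simps)
qed

section \<open>The three-term recursion\<close>

text \<open>Integration by parts: the boundary terms of \<open>t * (sin t / t) ^ n * cos (r * t)\<close> vanish.\<close>
lemma laplace_polya_rec:
  assumes "n \<ge> 2"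
  shows "2 * real n * laplace_polya (Suc n) r =
    (real n + 1 + r) * laplace_polya n (r + 1) + (real n + 1 - r) * laplace_polya n (r - 1)"
proof -
  define g where "g = (\<lambda>n r t :: real. (sin t / t) ^ n * cos (r * t))"
  \<comment> \<open>This is the derivative of \<open>F\<close>, with
    \<open>cos t * cos (r * t)\<close> and \<open>sin t * sin (r * t)\<close> rewritten through the
    cosines of \<open>(r + 1) * t\<close> and \<open>(r - 1) * t\<close>.\<close>
  define f where "f = (\<lambda>t. (real n + 1 + r) / 2 * g n (r + 1) t + (real n + 1 - r) / 2 * g n (r - 1) t
    - real n * g (Suc n) r t)"
  define F where "F = (\<lambda>t. sin t * (sin t / t) ^ n * cos (r * t))"
  have int: "set_integrable lborel {0<..} (g m q)" if "m \<ge> 2" for m q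
    unfolding g_def by (rule set_integrable_sinc_power_bounded[OF that]) auto
  have val: "(LBINT t:{0<..}. g m q t) = pi / 2 * laplace_polya m q" if "m \<ge> 2" for m q
    using laplace_polya_eq_LBINT[OF that, of q] by (simp add: g_def)
  have int_f: "set_integrable lborel {0<..} f"
    unfolding f_def using assms by (intro set_integral_add set_integral_diff set_integrable_mult_right int) auto
  have "(LBINT t:{0<..}. f t) = (real n + 1 + r) / 2 * (pi / 2 * laplace_polya n (r + 1)) +
      (real n + 1 - r) / 2 * (pi / 2 * laplace_polya n (r - 1)) - real n * (pi / 2 * laplace_polya (Suc n) r)"
    unfolding f_def using assms int by (simp add: set_integral_add set_integral_diff val)
  moreover have "(LBINT x=0..\<infinity>. f x) = 0 - 0"
  proof (rule interval_integral_FTC_integrable[where F = F])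
    show "(F has_vector_derivative f x) (at x)" if "0 < ereal x" for x
    proof -
      have x: "x > 0" using that by simp
      obtain k where n: "n = Suc k" using assms by (cases n) auto
      have "((\<lambda>t. sin t / t) has_real_derivative (cos x * x - sin x) / x\<^sup>2) (at x)"
        using x by (auto intro!: derivative_eq_intros simp: power2_eq_square)
      then have pow: "((\<lambda>t. (sin t / t) ^ n) has_real_derivative
          real n * (sin x / x) ^ k * ((cos x * x - sin x) / x\<^sup>2)) (at x)"
        by (rule DERIV_power[THEN DERIV_cong]) (simp add: n)
      have "(F has_real_derivative
         cos x * (sin x / x) ^ n * cos (r * x) +
         sin x * (real n * (sin x / x) ^ k * ((cos x * x - sin x) / x\<^sup>2)) * cos (r * x) -
         sin x * (sin x / x) ^ n * (r * sin (r * x))) (at x)"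
        unfolding F_def by (rule derivative_eq_intros pow refl)+ (simp add: algebra_simps)
      also have "sin x * (real n * (sin x / x) ^ k * ((cos x * x - sin x) / x\<^sup>2)) =
          real n * (sin x / x) ^ n * (cos x - sin x / x)"
        using x by (simp add: n field_simps power2_eq_square)
      also have "cos x * (sin x / x) ^ n * cos (r * x) +
         real n * (sin x / x) ^ n * (cos x - sin x / x) * cos (r * x) -
         sin x * (sin x / x) ^ n * (r * sin (r * x)) = f x"
        by (simp add: f_def g_def ring_distribs cos_add cos_diff) (simp add: field_simps)
      finally show ?thesis
        by (simp add: has_real_derivative_iff_has_vector_derivative)
    qed
    show "isCont f x" if "0 < ereal x" for x
      unfolding f_def g_def using that by (auto intro!: continuous_intros)
    show "set_integrable lborel (einterval 0 \<infinity>) f"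
      using int_f by (simp add: zero_ereal_def)
    have "(F \<longlongrightarrow> sin 0 * 1 ^ n * cos (r * 0)) (at 0)"
      unfolding F_def by (intro tendsto_intros sinc_at_0)
    then have "(F \<longlongrightarrow> 0) (at_right 0)"
      by (auto intro: tendsto_within_subset)
    then show "((F \<circ> real_of_ereal) \<longlongrightarrow> 0) (at_right 0)"
      unfolding zero_ereal_def ereal_tendsto_simps .
    have sinc_top: "((\<lambda>t. sin t / t :: real) \<longlongrightarrow> 0) at_top"
    proof (rule Lim_null_comparison)
      show "\<forall>\<^sub>F t in at_top. norm (sin t / t :: real) \<le> 1 / t"
        using eventually_gt_at_top[of 0] by eventually_elim (simp add: divide_right_mono)
      show "((\<lambda>t. 1 / t :: real) \<longlongrightarrow> 0) at_top"
        by (intro tendsto_divide_0[OF tendsto_const] filterlim_at_top_imp_at_infinity filterlim_ident)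
    qed
    have "(F \<longlongrightarrow> 0) at_top"
    proof (rule Lim_null_comparison)
      show "((\<lambda>t :: real. \<bar>sin t / t\<bar> ^ n) \<longlongrightarrow> 0) at_top"
        by (rule tendsto_null_power[OF tendsto_rabs_zero[OF sinc_top]]) (use assms in simp)
      show "\<forall>\<^sub>F t in at_top. norm (F t) \<le> \<bar>sin t / t\<bar> ^ n"
      proof (rule always_eventually, rule allI)
        fix t :: real
        have "\<bar>sin t\<bar> * \<bar>cos (r * t)\<bar> \<le> 1 * 1"
          by (intro mult_mono) auto
        then have "\<bar>sin t / t\<bar> ^ n * (\<bar>sin t\<bar> * \<bar>cos (r * t)\<bar>) \<le> \<bar>sin t / t\<bar> ^ n"
          by (intro mult_left_le) auto
        then show "norm (F t) \<le> \<bar>sin t / t\<bar> ^ n"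
          by (simp add: F_def abs_mult power_abs mult_ac)
      qed
    qed
    then show "((F \<circ> real_of_ereal) \<longlongrightarrow> 0) (at_left \<infinity>)"
      unfolding ereal_tendsto_simps .
  qed simp
  ultimately have "pi * ((real n + 1 + r) * laplace_polya n (r + 1) +
      (real n + 1 - r) * laplace_polya n (r - 1)) = pi * (2 * real n * laplace_polya (Suc n) r)"
    by (simp add: interval_integral_to_infinity_eq zero_ereal_def field_simps)
  then show ?thesis by simp
qed

section \<open>Support and positivity at the integers\<close>

text \<open>J_n is twice the density of a sum of n independent uniform variables on [-1, 1], hence
  supported in [-n, n]. At the integers the recursion suffices: both values on its right side vanish
  by induction.\<close>

lemma laplace_polya_eq_0:
  assumes "n \<ge> 2" "s \<ge> n"
  shows "laplace_polya n (real s) = 0"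
  using assms
proof (induction n arbitrary: s rule: dec_induct)
  case base
  then show ?case by (simp add: laplace_polya_2)
next
  case (step n)
  obtain k where k: "s = Suc k" "k \<ge> n" using step.prems by (cases s) auto
  have "laplace_polya n (real (k + 2)) = 0" "laplace_polya n (real k) = 0"
    using k by (intro step.IH; simp)+
  then show ?case
    using laplace_polya_rec[OF step.hyps(1), of "real s"] step.hyps k by (simp add: add_ac)
qed

text \<open>Both terms of the recursion are nonnegative, and the one at \<open>s - 1\<close> is
  positive; for \<open>s = 0\<close>, evenness moves -1 to 1.\<close>

lemma laplace_polya_pos:
  assumes "n \<ge> 2" "s < n"
  shows "laplace_polya n (real s) > 0"
  using assms
proof (induction n arbitrary: s rule: dec_induct)
  case base
  then have "s = 0 \<or> s = 1" by auto
  then show ?case by (auto simp: laplace_polya_2)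
next
  case (step n)
  have nonneg: "laplace_polya n (real k) \<ge> 0" for k
    using step.IH[of k] laplace_polya_eq_0[OF step.hyps(1), of k] by (cases "k < n") auto
  have "laplace_polya n (real s - 1) > 0"
  proof (cases s)
    case 0
    then show ?thesis
      using step.IH[of 1] step.hyps laplace_polya_uminus[of n 1] by simp
  next
    case (Suc k)
    then show ?thesis using step.IH[of k] step.prems by simp
  qed
  then have "(real n + 1 - real s) * laplace_polya n (real s - 1) > 0"
    using step.prems by simp
  moreover have "(real n + 1 + real s) * laplace_polya n (real s + 1) \<ge> 0"
    using nonneg[of "Suc s"] by (simp add: add.commute)
  ultimately have "2 * real n * laplace_polya (Suc n) (real s) > 0"
    unfolding laplace_polya_rec[OF step.hyps(1)] by linarith
  then show ?case
    by (simp add: zero_less_mult_iff)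
qed

section \<open>The bound on ratios of neighbouring values\<close>

text \<open>
  The quotient \<open>ratio_poly (n + 1) s / ratio_poly (n + 1) (- s)\<close> is \<open>1 - 6 s / n + O(1 / n\<^sup>2)\<close>,
  as is the ratio of the Gaussian densities of variance \<open>n / 3\<close> at \<open>s + 1\<close> and \<open>s - 1\<close>.
  The other two coefficients were found by a numerical search.
\<close>
definition ratio_poly :: "real \<Rightarrow> real \<Rightarrow> real" where
  "ratio_poly m s = 2 * m\<^sup>2 - 6 * m * s + 5 * s\<^sup>2 - 2"

text \<open>Serves the points where the left side of the ratio bound vanishes and only the sign of
  the right side matters.\<close>

lemma ratio_poly_ge:
  assumes "s \<ge> 2"
  shows "ratio_poly m s \<ge> 0"
proof -
  have "2 * ratio_poly m s = (2 * m - 3 * s)\<^sup>2 + (s\<^sup>2 - 4)"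
    by (simp add: ratio_poly_def power2_eq_square algebra_simps)
  moreover have "s\<^sup>2 \<ge> 4"
    using power_mono[OF assms, of 2] by simp
  ultimately show ?thesis
    using zero_le_power2[of "2 * m - 3 * s"] by linarith
qed

lemma ratio_poly_uminus_pos:
  assumes "m \<ge> 2" "s \<ge> 0"
  shows "ratio_poly m (- s) > 0"
proof -
  have "m\<^sup>2 \<ge> 4"
    using power_mono[OF assms(1), of 2] by simp
  moreover have "m * s \<ge> 0"
    using assms by simp
  moreover have "ratio_poly m (- s) = 2 * m\<^sup>2 + 6 * (m * s) + 5 * s\<^sup>2 - 2"
    by (simp add: ratio_poly_def)
  ultimately show ?thesis
    using zero_le_power2[of s] by linarith
qed

text \<open>Twice the polynomial is \<open>(2 * m - 3 * s) ^ 2 + s ^ 2 - 4\<close>. For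
  \<open>s \<le> 6\<close> the two squares sum to at least 18, and for larger \<open>s\<close> the
  second one alone exceeds 4.\<close>

lemma ratio_poly_pos:
  assumes "m \<ge> s + 3"
  shows "ratio_poly m s > 0"
proof -
  have "2 * ratio_poly m s = (2 * m - 3 * s)\<^sup>2 + s\<^sup>2 - 4"
    by (simp add: ratio_poly_def power2_eq_square algebra_simps)
  moreover have "(2 * m - 3 * s)\<^sup>2 + s\<^sup>2 > 4"
  proof (cases "s \<le> 6")
    case True
    then have "(2 * m - 3 * s)\<^sup>2 \<ge> (6 - s)\<^sup>2"
      using assms by (intro power_mono) auto
    moreover have "(6 - s)\<^sup>2 + s\<^sup>2 = 2 * (s - 3)\<^sup>2 + 18"
      by (simp add: power2_eq_square algebra_simps)
    ultimately show ?thesis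
      using zero_le_power2[of "s - 3"] by linarith
  next
    case False
    then have "s\<^sup>2 > 4"
      using power_strict_mono[of 2 s 2] by simp
    then show ?thesis
      using zero_le_power2[of "2 * m - 3 * s"] by linarith
  qed
  ultimately show ?thesis by linarith
qed

text \<open>The recursion map preserves the bound: this is the inequality left, with denominators
  cleared, when the neighbouring ratios are replaced by their bounds at \<open>s + 1\<close> and
  \<open>s - 1\<close>. Here \<open>n\<close> is one more than the level from which the induction
  steps.\<close>

lemma ratio_poly_step:
  fixes n s :: real
  assumes "s \<ge> 1" "n \<ge> s + 2"
  shows "ratio_poly n (s - 1) * ratio_poly (n + 1) (- s) *
      ((n + s + 1) * ratio_poly n (s + 1) + (n - s - 1) * ratio_poly n (- s - 1))
    \<le> ratio_poly (n + 1) s * ratio_poly n (- s - 1) *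
      ((n + s - 1) * ratio_poly n (s - 1) + (n - s + 1) * ratio_poly n (1 - s))"
proof -
  define i where "i = s - 1"
  define j where "j = n - s - 2"
  have ij: "i \<ge> 0" "j \<ge> 0" "s = 1 + i" "n = 3 + i + j"
    using assms by (auto simp: i_def j_def)
  \<comment> \<open>In these variables every coefficient of the difference is positive.\<close>
  have "ratio_poly (n + 1) s * ratio_poly n (- s - 1) *
      ((n + s - 1) * ratio_poly n (s - 1) + (n - s + 1) * ratio_poly n (1 - s))
    - ratio_poly n (s - 1) * ratio_poly (n + 1) (- s) *
      ((n + s + 1) * ratio_poly n (s + 1) + (n - s - 1) * ratio_poly n (- s - 1)) =
    168 * i ^ 6 + 1272 * i ^ 5 + 264 * i ^ 5 * j + 3168 * i ^ 4 + 1464 * i ^ 4 * j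
    + 144 * i ^ 4 * j ^ 2 + 3672 * i ^ 3 + 3600 * i ^ 3 * j + 840 * i ^ 3 * j ^ 2
    + 48 * i ^ 3 * j ^ 3 + 6744 * i ^ 2 + 9216 * i ^ 2 * j + 3240 * i ^ 2 * j ^ 2
    + 336 * i ^ 2 * j ^ 3 + 13200 * i + 16704 * i * j + 6816 * i * j ^ 2 + 1056 * i * j ^ 3
    + 48 * i * j ^ 4 + 8064 + 9888 * j + 4272 * j ^ 2 + 768 * j ^ 3 + 48 * j ^ 4"
    unfolding ratio_poly_def ij by algebra
  also have "\<dots> \<ge> 0"
    using ij(1,2) by (intro add_nonneg_nonneg mult_nonneg_nonneg zero_le_power) auto
  finally show ?thesis by simp
qed

text \<open>The bound on the ratio is multiplied out so that it also covers points where the value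
  at \<open>s - 1\<close> is zero.\<close>

lemma laplace_polya_ratio_bound:
  assumes "n \<ge> 2"
  shows "laplace_polya n (real s + 1) * ratio_poly (real n + 1) (- real s)
    \<le> ratio_poly (real n + 1) (real s) * laplace_polya n (real s - 1)"
  using assms
proof (induction n arbitrary: s rule: dec_induct)
  case base
  show ?case
  proof (cases "s = 0")
    case False
    then have "laplace_polya 2 (real s + 1) = 0" "laplace_polya 2 (real s - 1) \<ge> 0"
      by (auto simp: laplace_polya_2)
    \<comment> \<open>The point \<open>s = 1\<close> lies outside \<open>ratio_poly_ge\<close>;
      there the value is 3.\<close>
    moreover have "ratio_poly 3 (real s) \<ge> 0"
      using False ratio_poly_ge[of "real s" 3] by (cases "s = 1") (auto simp: ratio_poly_def)
    ultimately show ?thesis by simp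
  qed (simp add: laplace_polya_2)
next
  case (step n)
  \<comment> \<open>At \<open>s = 0\<close> evenness gives equality, and for
    \<open>s \<ge> n\<close> the value at \<open>s + 1\<close> vanishes. The remaining range gives
    exactly the \<open>N \<ge> x + 2\<close> that \<open>ratio_poly_step\<close> requires.\<close>
  consider "s = 0" | "s \<ge> n" | "1 \<le> s" "s < n" by linarith
  then show ?case
  proof cases
    case 1
    then show ?thesis using laplace_polya_uminus[of "Suc n" 1] by simp
  next
    case 2
    have "laplace_polya (Suc n) (real (s + 1)) = 0"
      using 2 step.hyps by (intro laplace_polya_eq_0) auto
    moreover have "laplace_polya (Suc n) (real (s - 1)) \<ge> 0"
      using laplace_polya_pos[of "Suc n" "s - 1"] laplace_polya_eq_0[of "Suc n" "s - 1"] step.hyps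
      by (cases "s - 1 < Suc n") auto
    moreover have "ratio_poly (real (Suc n) + 1) (real s) \<ge> 0"
      using 2 step.hyps by (intro ratio_poly_ge) auto
    ultimately show ?thesis
      using 2 step.hyps by (simp add: of_nat_diff add.commute)
  next
    case 3
    define N x where "N = real n + 1" and "x = real s"
    have x: "x \<ge> 1" "N \<ge> x + 2" "N > 0"
      using 3 by (auto simp: N_def x_def)
    define a b c where "a = laplace_polya n (x + 2)" and "b = laplace_polya n x"
      and "c = laplace_polya n (x - 2)"
    define p p' q q' P P' where "p = ratio_poly N (x + 1)" and "p' = ratio_poly N (- x - 1)"
      and "q = ratio_poly N (x - 1)" and "q' = ratio_poly N (1 - x)"
      and "P = ratio_poly (N + 1) x" and "P' = ratio_poly (N + 1) (- x)"
    have ab: "a * p' \<le> p * b"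
    proof -
      have "- real (s + 1) = - x - 1"
        by (simp add: x_def)
      then show ?thesis
        using step.IH[of "s + 1"]
        by (simp only:) (simp add: a_def b_def p_def p'_def N_def x_def add_ac)
    qed
    have bc: "b * q' \<le> q * c"
      using step.IH[of "s - 1"] 3
      by (simp add: b_def c_def q_def q'_def N_def x_def of_nat_diff add_ac)
    have b: "b \<ge> 0"
      using laplace_polya_pos[of n s] step.hyps 3 by (simp add: b_def x_def)
    have p': "p' > 0" and P': "P' > 0"
      using ratio_poly_uminus_pos[of N "x + 1"] ratio_poly_uminus_pos[of "N + 1" x] x
      by (simp_all add: p'_def P'_def)
    have q: "q > 0" and P: "P > 0"
      unfolding q_def P_def using x by (intro ratio_poly_pos; simp)+
    \<comment> \<open>The factor \<open>q * p'\<close> lets \<open>ab\<close> and \<open>bc\<close>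
      be inserted without division; between the two insertions, \<open>ratio_poly_step\<close> is
      applied with the common factor \<open>b\<close>.\<close>
    have "(q * p') * (((N + x + 1) * a + (N - x - 1) * b) * P') =
        q * P' * ((N + x + 1) * (a * p') + (N - x - 1) * p' * b)"
      by (simp add: algebra_simps)
    also have "\<dots> \<le> q * P' * ((N + x + 1) * (p * b) + (N - x - 1) * p' * b)"
      using q P' x ab by (intro mult_left_mono add_right_mono) auto
    also have "\<dots> = b * (q * P' * ((N + x + 1) * p + (N - x - 1) * p'))"
      by (simp add: algebra_simps)
    also have "\<dots> \<le> b * (P * p' * ((N + x - 1) * q + (N - x + 1) * q'))"
      unfolding p_def p'_def q_def q'_def P_def P'_def
      using b x by (intro mult_left_mono ratio_poly_step)
    also have "\<dots> = P * p' * ((N + x - 1) * q * b + (N - x + 1) * (b * q'))"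
      by (simp add: algebra_simps)
    also have "\<dots> \<le> P * p' * ((N + x - 1) * q * b + (N - x + 1) * (q * c))"
      using P p' x bc by (intro mult_left_mono add_left_mono) auto
    also have "\<dots> = (q * p') * (P * ((N + x - 1) * b + (N - x + 1) * c))"
      by (simp add: algebra_simps)
    finally have "((N + x + 1) * a + (N - x - 1) * b) * P' \<le> P * ((N + x - 1) * b + (N - x + 1) * c)"
      using q p' by simp
    moreover have "(N + x + 1) * a + (N - x - 1) * b = 2 * real n * laplace_polya (Suc n) (x + 1)"
      using laplace_polya_rec[OF step.hyps(1), of "x + 1"] by (simp add: a_def b_def N_def algebra_simps)
    moreover have "(N + x - 1) * b + (N - x + 1) * c = 2 * real n * laplace_polya (Suc n) (x - 1)"
      using laplace_polya_rec[OF step.hyps(1), of "x - 1"] by (simp add: b_def c_def N_def algebra_simps)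
    ultimately have "2 * real n * (laplace_polya (Suc n) (x + 1) * P') \<le>
        2 * real n * (P * laplace_polya (Suc n) (x - 1))"
      by (simp add: mult_ac)
    then show ?thesis
      using step.hyps by (simp add: P_def P'_def N_def x_def add_ac)
  qed
qed

section \<open>From the ratio bound to the inequality at 0\<close>

theorem corollary1p5:
  fixes n :: nat
  assumes "n \<ge> 2"
  shows "(real n + 3) * laplace_polya (n + 2) 0 < (real n + 2) * laplace_polya n 0"
proof -
  define m where "m = real n"
  define J0 J1 J2 K where "J0 = laplace_polya n 0" and "J1 = laplace_polya (Suc n) 1"
    and "J2 = laplace_polya n 2" and "K = laplace_polya (n + 2) 0"
  have m: "m \<ge> 2"
    using assms by (simp add: m_def)
  have J0: "J0 > 0"
    using laplace_polya_pos[of n 0] assms by (simp add: J0_def)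
  \<comment> \<open>The ratio bound at \<open>s = 1\<close>, with \<open>ratio_poly (m + 1)\<close>
    evaluated at -1 and 1.\<close>
  have bound: "J2 * (2 * m\<^sup>2 + 10 * m + 11) \<le> (2 * m\<^sup>2 - 2 * m - 1) * J0"
    using laplace_polya_ratio_bound[OF assms, of 1]
    by (simp add: J0_def J2_def m_def ratio_poly_def power2_eq_square algebra_simps)
  have J2: "(m + 2) * (m + 3) * J2 < m * (m - 1) * J0"
  proof -
    define d where "d = 2 * m\<^sup>2 + 10 * m + 11"
    have d: "d > 0"
      unfolding d_def using m by (intro add_nonneg_pos add_nonneg_nonneg) auto
    have "d * ((m + 2) * (m + 3) * J2) = (m + 2) * (m + 3) * (J2 * d)"
      by (simp add: mult_ac)
    also have "\<dots> \<le> (m + 2) * (m + 3) * ((2 * m\<^sup>2 - 2 * m - 1) * J0)"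
      unfolding d_def using m bound by (intro mult_left_mono) auto
    \<comment> \<open>The surplus \<open>6 * (m + 1) * J0\<close> is the source of the strict
      inequality.\<close>
    also have "\<dots> = d * (m * (m - 1) * J0) - 6 * (m + 1) * J0"
      by (simp add: d_def power2_eq_square algebra_simps)
    also have "\<dots> < d * (m * (m - 1) * J0)"
      using m J0 by simp
    finally show ?thesis
      using d by simp
  qed
  \<comment> \<open>The factor \<open>2 * m * (m + 1)\<close> allows the recursion to be used at
    levels \<open>n + 1\<close> and \<open>n\<close> without division. It reappears at the end as
    \<open>m * (m - 1) + m * (m + 3)\<close>.\<close>
  have "2 * m * (m + 1) * ((m + 3) * K) = 2 * m * (m + 3) * ((m + 1) * K)"
    by (simp add: algebra_simps)
  also have "(m + 1) * K = (m + 2) * J1"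
    using laplace_polya_rec[of "Suc n" 0] laplace_polya_uminus[of "Suc n" 1] assms
    by (simp add: K_def J1_def m_def algebra_simps)
  also have "2 * m * (m + 3) * ((m + 2) * J1) = (m + 3) * (m + 2) * (2 * m * J1)"
    by (simp add: mult_ac)
  also have "2 * m * J1 = (m + 2) * J2 + m * J0"
    using laplace_polya_rec[of n 1] assms by (simp add: J0_def J1_def J2_def m_def algebra_simps)
  also have "(m + 3) * (m + 2) * ((m + 2) * J2 + m * J0) =
      (m + 2) * ((m + 2) * (m + 3) * J2 + m * (m + 3) * J0)"
    by (simp add: algebra_simps)
  also have "\<dots> < (m + 2) * (m * (m - 1) * J0 + m * (m + 3) * J0)"
    using J2 m by (intro mult_strict_left_mono add_strict_right_mono) auto
  also have "\<dots> = 2 * m * (m + 1) * ((m + 2) * J0)"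
    by (simp add: algebra_simps)
  finally show ?thesis
    using m by (simp add: K_def J0_def m_def)
qed

end
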